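(* Let $X$ be a set, $E$ a set of parameters, and let $\boldsymbol{\Sigma}=\{\Sigma_e : e\in E\}$ be a family of crisp topologies on $X$ indexed by $E$. Then $(X,\Sigma_e)$ is a $T_2$-space for each $e\in E$ if and only if $\mathcal{T}(\boldsymbol{\Sigma})$ is a soft $T_2$-space.
   Context: A "crisp" topology is an ordinary topology. A soft set over $X$ (with parameter set $E$) is $(F,E)=\{(e,F(e)) : e\in E\}$ where $F:E\to\mathcal{P}(X)$ is a map; $S_E(X)$ is the family of all soft sets. For $x\in X$, $x\in(F,E)$ ("$(F,E)$ contains $x$") means $x\in F(e)$ for every $e\in E$. Unions and intersections of soft sets are taken parameterwise. The null soft set $\widetilde{\Phi}$ has $F(e)=\emptyset$ for all $e$; the absolute soft set $\widetilde{X}$ has $F(e)=X$ for all $e$. A soft topology on $X$ is a collection of soft sets containing $\widetilde{\Phi}$ and $\widetilde{X}$, closed under pairwise intersections and arbitrary unions; its members are called soft open sets. The soft topology generated by $\boldsymbol{\Sigma}=\{\Sigma_e : e\in E\}$ is $\mathcal{T}(\boldsymbol{\Sigma})=\{(F,E)\in S_E(X) : F(e)\in\Sigma_e \text{ for all } e\in E\}$. A soft topology on $X$ is soft $T_2$ (soft Hausdorff) if for all $x,y\in X$ with $x\neq y$ there exist soft open sets $(U,E),(V,E)$ with $x\in(U,E)$, $y\in(V,E)$ and $(U,E)\cap(V,E)=\widetilde{\Phi}$ (parameterwise intersection). *)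

theory Defs
  imports "HOL-Analysis.Analysis"
begin

text \<open>
  A soft set over \<open>X\<close> with parameter set \<open>E\<close> is a map from \<open>E\<close> to the subsets of \<open>X\<close>,
  represented by an extensional function on \<open>E\<close>; extensionality makes equality of soft sets
  coincide with equality of their graphs over \<open>E\<close>.
\<close>

definition soft_sets :: "'e set \<Rightarrow> 'a set \<Rightarrow> ('e \<Rightarrow> 'a set) set" where
  "soft_sets E X = (E \<rightarrow>\<^sub>E Pow X)"

definition soft_mem :: "'e set \<Rightarrow> 'a \<Rightarrow> ('e \<Rightarrow> 'a set) \<Rightarrow> bool" where
  "soft_mem E x F \<longleftrightarrow> (\<forall>e\<in>E. x \<in> F e)"

definition soft_null :: "'e set \<Rightarrow> 'e \<Rightarrow> 'a set" where
  "soft_null E = (\<lambda>e\<in>E. {})"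

definition soft_absolute :: "'e set \<Rightarrow> 'a set \<Rightarrow> 'e \<Rightarrow> 'a set" where
  "soft_absolute E X = (\<lambda>e\<in>E. X)"

definition soft_inter :: "'e set \<Rightarrow> ('e \<Rightarrow> 'a set) \<Rightarrow> ('e \<Rightarrow> 'a set) \<Rightarrow> 'e \<Rightarrow> 'a set" where
  "soft_inter E F G = (\<lambda>e\<in>E. F e \<inter> G e)"

definition soft_Union :: "'e set \<Rightarrow> ('e \<Rightarrow> 'a set) set \<Rightarrow> 'e \<Rightarrow> 'a set" where
  "soft_Union E \<A> = (\<lambda>e\<in>E. \<Union>F\<in>\<A>. F e)"

definition soft_topology :: "'e set \<Rightarrow> 'a set \<Rightarrow> ('e \<Rightarrow> 'a set) set \<Rightarrow> bool" where
  "soft_topology E X \<T> \<longleftrightarrow>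
     \<T> \<subseteq> soft_sets E X \<and>
     soft_null E \<in> \<T> \<and> soft_absolute E X \<in> \<T> \<and>
     (\<forall>F\<in>\<T>. \<forall>G\<in>\<T>. soft_inter E F G \<in> \<T>) \<and>
     (\<forall>\<A>. \<A> \<subseteq> \<T> \<longrightarrow> soft_Union E \<A> \<in> \<T>)"

definition soft_T2_space :: "'e set \<Rightarrow> 'a set \<Rightarrow> ('e \<Rightarrow> 'a set) set \<Rightarrow> bool" where
  "soft_T2_space E X \<T> \<longleftrightarrow>
     soft_topology E X \<T> \<and>
     (\<forall>x\<in>X. \<forall>y\<in>X. x \<noteq> y \<longrightarrow>
        (\<exists>U\<in>\<T>. \<exists>V\<in>\<T>. soft_mem E x U \<and> soft_mem E y V \<and> soft_inter E U V = soft_null E))"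

definition generated_soft_topology ::
    "'e set \<Rightarrow> 'a set \<Rightarrow> ('e \<Rightarrow> 'a topology) \<Rightarrow> ('e \<Rightarrow> 'a set) set" where
  "generated_soft_topology E X \<Sigma> = {F \<in> soft_sets E X. \<forall>e\<in>E. openin (\<Sigma> e) (F e)}"

lemma soft_topology_generated_soft_topology:
  assumes "\<And>e. e \<in> E \<Longrightarrow> topspace (\<Sigma> e) = X"
  shows "soft_topology E X (generated_soft_topology E X \<Sigma>)"
proof -
  have X: "openin (\<Sigma> e) X" if "e \<in> E" for e
    using assms[OF that] openin_topspace[of "\<Sigma> e"] by simp
  have mem: "(\<lambda>e\<in>E. f e) \<in> generated_soft_topology E X \<Sigma>"
    if "\<And>e. e \<in> E \<Longrightarrow> openin (\<Sigma> e) (f e)" for f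
    using openin_subset[OF that] that assms
    by (auto simp: generated_soft_topology_def soft_sets_def)
  have op: "openin (\<Sigma> e) (F e)" if "F \<in> generated_soft_topology E X \<Sigma>" "e \<in> E" for F e
    using that by (simp add: generated_soft_topology_def)
  have "soft_Union E \<A> \<in> generated_soft_topology E X \<Sigma>"
    if "\<A> \<subseteq> generated_soft_topology E X \<Sigma>" for \<A>
    unfolding soft_Union_def
  proof (rule mem)
    fix e assume "e \<in> E"
    with that op have "\<forall>U\<in>(\<lambda>F. F e) ` \<A>. openin (\<Sigma> e) U" by blast
    then show "openin (\<Sigma> e) (\<Union>F\<in>\<A>. F e)" by (intro openin_Union) blast
  qed
  moreover have "soft_inter E F G \<in> generated_soft_topology E X \<Sigma>"
    if "F \<in> generated_soft_topology E X \<Sigma>" "G \<in> generated_soft_topology E X \<Sigma>" for F G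
    unfolding soft_inter_def by (intro mem openin_Int op that)
  moreover have "soft_null E \<in> generated_soft_topology E X \<Sigma>"
    unfolding soft_null_def by (intro mem openin_empty)
  moreover have "soft_absolute E X \<in> generated_soft_topology E X \<Sigma>"
    unfolding soft_absolute_def by (intro mem X)
  moreover have "generated_soft_topology E X \<Sigma> \<subseteq> soft_sets E X"
    by (auto simp: generated_soft_topology_def)
  ultimately show ?thesis
    unfolding soft_topology_def by blast
qed

end

theory Submission
  imports Defs
begin

text \<open>Everything is decided one parameter at a time: membership of a point, disjointness and
  softly open all mean that the corresponding crisp condition holds at every \<open>e\<close> in
  \<open>E\<close>, and the generated soft topology puts no relation between different parameters.
  So separating neighbourhoods chosen independently in each \<open>\<Sigma> e\<close> assemble into
  a separating pair of soft open sets (\<open>restrict_in_generated_soft_topology\<close>), and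
  conversely a soft separating pair, evaluated at \<open>e\<close>, separates the points in
  \<open>\<Sigma> e\<close>.\<close>

text \<open>Both soft sets are restrictions to \<open>E\<close>, so they agree outside
  \<open>E\<close> by default and only the values on \<open>E\<close> matter.\<close>

lemma soft_inter_eq_null_iff:
  "soft_inter E F G = soft_null E \<longleftrightarrow> (\<forall>e\<in>E. F e \<inter> G e = {})"
  by (auto simp: soft_inter_def soft_null_def fun_eq_iff restrict_def)

text \<open>This is the assembly step: any choice of one open set per parameter is allowed.
  Restricting to \<open>E\<close> supplies the extensionality that \<open>soft_sets\<close> demands,
  and open sets lie in the common carrier \<open>X\<close>.\<close>

lemma restrict_in_generated_soft_topology:
  assumes "\<And>e. e \<in> E \<Longrightarrow> topspace (\<Sigma> e) = X"
    and "\<And>e. e \<in> E \<Longrightarrow> openin (\<Sigma> e) (U e)"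
  shows "restrict U E \<in> generated_soft_topology E X \<Sigma>"
  using openin_subset[OF assms(2)] assms
  by (auto simp: generated_soft_topology_def soft_sets_def)

theorem theorem5p6:
  fixes X :: "'a set" and E :: "'e set" and \<Sigma> :: "'e \<Rightarrow> 'a topology"
  assumes "\<And>e. e \<in> E \<Longrightarrow> topspace (\<Sigma> e) = X"
  shows "(\<forall>e\<in>E. Hausdorff_space (\<Sigma> e)) \<longleftrightarrow>
         soft_T2_space E X (generated_soft_topology E X \<Sigma>)"
proof
  assume H: "\<forall>e\<in>E. Hausdorff_space (\<Sigma> e)"
  let ?T = "generated_soft_topology E X \<Sigma>"
  have "\<exists>U\<in>?T. \<exists>V\<in>?T. soft_mem E x U \<and> soft_mem E y V \<and> soft_inter E U V = soft_null E"
    if "x \<in> X" "y \<in> X" "x \<noteq> y" for x y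
  proof -
    have "\<forall>e\<in>E. \<exists>U V. openin (\<Sigma> e) U \<and> openin (\<Sigma> e) V \<and> x \<in> U \<and> y \<in> V \<and> disjnt U V"
      using H assms that unfolding Hausdorff_space_def by simp
    \<comment> \<open>The axiom of choice turns the separating pairs, one for each parameter, into
      two functions of \<open>e\<close>.\<close>
    then obtain U V where UV: "\<And>e. e \<in> E \<Longrightarrow>
        openin (\<Sigma> e) (U e) \<and> openin (\<Sigma> e) (V e) \<and> x \<in> U e \<and> y \<in> V e \<and> disjnt (U e) (V e)"
      by metis
    have "restrict U E \<in> ?T" "restrict V E \<in> ?T"
      using UV assms by (auto intro!: restrict_in_generated_soft_topology)
    moreover have "soft_mem E x (restrict U E)" "soft_mem E y (restrict V E)"
      using UV by (auto simp: soft_mem_def)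
    moreover have "soft_inter E (restrict U E) (restrict V E) = soft_null E"
      using UV by (auto simp: soft_inter_eq_null_iff disjnt_def)
    ultimately show ?thesis by blast
  qed
  then show "soft_T2_space E X ?T"
    using soft_topology_generated_soft_topology[of E \<Sigma> X] assms
    by (simp add: soft_T2_space_def)
next
  assume T2: "soft_T2_space E X (generated_soft_topology E X \<Sigma>)"
  show "\<forall>e\<in>E. Hausdorff_space (\<Sigma> e)"
    unfolding Hausdorff_space_def
  proof (intro ballI allI impI)
    fix e x y
    assume e: "e \<in> E" and xy: "x \<in> topspace (\<Sigma> e) \<and> y \<in> topspace (\<Sigma> e) \<and> x \<noteq> y"
    obtain U V where "U \<in> generated_soft_topology E X \<Sigma>" "V \<in> generated_soft_topology E X \<Sigma>"
      "soft_mem E x U" "soft_mem E y V" "\<forall>e\<in>E. U e \<inter> V e = {}"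
      using T2 xy assms[OF e] unfolding soft_T2_space_def soft_inter_eq_null_iff by blast
    \<comment> \<open>The witnesses are the slices \<open>U e\<close> and \<open>V e\<close> at the
      fixed parameter.\<close>
    then show "\<exists>U V. openin (\<Sigma> e) U \<and> openin (\<Sigma> e) V \<and> x \<in> U \<and> y \<in> V \<and> disjnt U V"
      using e unfolding generated_soft_topology_def soft_mem_def disjnt_def by blast
  qed
qed

end
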